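(* Let $W\subset S^1$ with $|W|=4$ satisfy condition $T''(W)$: $(W+\tfrac i5)\cap W=\emptyset$ for $i=1,2,3,4$ (equivalently, the four elements of $W$ lie in distinct orbits of the rotation $x\mapsto x+\tfrac15$). Then either $P(W)$ holds, or $W\cong\{0,\tfrac14,\tfrac12,\tfrac34\}$.
   Context: Identify $S^1$ with $\mathbb{R}/\mathbb{Z}$. The group $O(2)$ acts on $S^1$ by translations $x\mapsto x+a$ and reflections $x\mapsto -x+2a$. A coloring $c:S^1\to\{R,B\}$ is distinguishing if no non-identity $\gamma\in O(2)$ satisfies $c\circ\gamma=c$. For $W\subset S^1$ with trivial pointwise stabilizer in $O(2)$, $P(W)$ holds if every precoloring $c:S^1\setminus W\to\{R,B\}$ extends to a distinguishing coloring of $S^1$. Write $W\cong W'$ if $W'=\gamma(W)$ for some $\gamma\in O(2)$. *)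

theory Defs
  imports Complex_Main
begin

text \<open>The circle S^1 = R/Z is represented by its canonical set of
representatives [0,1) of reals; arithmetic is taken modulo 1 via frac.\<close>

definition S1 :: "real set" where
  "S1 = {0..<1}"

datatype O2 = Rot real | Refl real

fun act :: "O2 \<Rightarrow> real \<Rightarrow> real" where
  "act (Rot a) x = frac (x + a)"
| "act (Refl a) x = frac (- x + 2 * a)"

definition is_identity :: "O2 \<Rightarrow> bool" where
  "is_identity g \<longleftrightarrow> (\<forall>x\<in>S1. act g x = x)"

text \<open>Colorings S^1 -> {R,B}, with R = True, B = False; only values on S1 matter.\<close>
definition distinguishing :: "(real \<Rightarrow> bool) \<Rightarrow> bool" where
  "distinguishing c \<longleftrightarrow>
     (\<forall>g. (\<forall>x\<in>S1. c (act g x) = c x) \<longrightarrow> is_identity g)"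

definition trivial_pointwise_stabilizer :: "real set \<Rightarrow> bool" where
  "trivial_pointwise_stabilizer W \<longleftrightarrow>
     (\<forall>g. (\<forall>x\<in>W. act g x = x) \<longrightarrow> is_identity g)"

definition P :: "real set \<Rightarrow> bool" where
  "P W \<longleftrightarrow> (\<forall>c :: real \<Rightarrow> bool. \<exists>d. distinguishing d \<and> (\<forall>x\<in>S1 - W. d x = c x))"

definition congruent_sets :: "real set \<Rightarrow> real set \<Rightarrow> bool" where
  "congruent_sets W W' \<longleftrightarrow> (\<exists>g. W' = act g ` W)"

definition T2 :: "real set \<Rightarrow> bool" where
  "T2 W \<longleftrightarrow> (\<forall>i::nat\<in>{1..4}. (\<lambda>x. frac (x + real i / 5)) ` W \<inter> W = {})"

end

theory Submission
  imports Defs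
begin

text \<open>
  It suffices that \<open>W\<close> contains a scalene triple: four points all of whose triples are isosceles form
  a square or are four vertices of a regular pentagon. Suppose that all eight recolorings of a
  triple \<open>X\<close> are symmetric; then \<open>X\<close> is symmetric, that is, isosceles.

  If some recoloring \<open>f\<close> is invariant under a nontrivial rotation, let \<open>H\<close> be the group of all such
  rotations. A motion changes the color \<open>f\<close> on a union of cosets of \<open>H\<close>, but a symmetry of a
  recoloring changes \<open>f\<close> at few points only. So \<open>f\<close> has the reflection at each point of \<open>X\<close>, and
  \<open>2 * (x - y) \<in> H\<close> for \<open>x, y \<in> X\<close>. If \<open>H\<close> has order 2, two of the points are antipodal and \<open>X\<close> is
  isosceles. If \<open>H\<close> is larger, points of \<open>X\<close> of different color are antipodal, so \<open>f\<close> is constant on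
  \<open>X\<close>, and \<open>X\<close> either inherits a symmetry from its recoloring or is a coset of \<open>H\<close>.

  Otherwise each recoloring has a unique reflection. Take \<open>d\<close> constant on \<open>X\<close>, with reflection
  \<open>u \<mapsto> k - u\<close>. Composing with the reflection of the recoloring at \<open>x\<close> gives a rotation under which \<open>d\<close>
  changes at exactly two points. Comparing these rotations for the points of \<open>X\<close> shows that, up
  to one point \<open>e\<close> on the axis, \<open>d\<close> is invariant under the rotations by \<open>e - x\<close>; then all
  subsets of \<open>{e} \<union> X\<close> containing \<open>e\<close> are symmetric, and so is \<open>X\<close>. The exception is an axis through
  two points of \<open>X\<close>; it cannot be the axis both for \<open>d\<close> and for its complement on \<open>X\<close>.
\<close>

section \<open>Motions and recolorings\<close>

class single_involution_group = ab_group_add +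
  assumes involution_unique:
    "s + s = 0 \<Longrightarrow> t + t = 0 \<Longrightarrow> s \<noteq> 0 \<Longrightarrow> t \<noteq> 0 \<Longrightarrow> s = t"

lemma at_most_two_halves:
  fixes x :: "'a::single_involution_group"
  assumes "x + x = k" "y + y = k" "z + z = k"
  shows "x = y \<or> x = z \<or> y = z"
proof (rule ccontr)
  assume distinct: "\<not> ?thesis"
  have "(x - z) + (x - z) = 0" "(y - z) + (y - z) = 0"
    using assms by (simp_all flip: add_diff_add)
  then have "x - z = y - z"
    by (rule involution_unique) (use distinct in simp_all)
  then show False using distinct by simp
qed

definition preserves :: "('a \<Rightarrow> 'a) \<Rightarrow> ('a \<Rightarrow> bool) \<Rightarrow> bool" where
  "preserves g d \<longleftrightarrow> (\<forall>u. d (g u) = d u)"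

abbreviation rot_inv :: "('a::ab_group_add \<Rightarrow> bool) \<Rightarrow> 'a \<Rightarrow> bool" where
  "rot_inv d t \<equiv> preserves (\<lambda>u. u + t) d"

abbreviation refl_inv :: "('a::ab_group_add \<Rightarrow> bool) \<Rightarrow> 'a \<Rightarrow> bool" where
  "refl_inv d k \<equiv> preserves (\<lambda>u. k - u) d"

definition motion :: "('a::ab_group_add \<Rightarrow> 'a) \<Rightarrow> bool" where
  "motion g \<longleftrightarrow> (\<exists>t. t \<noteq> 0 \<and> g = (\<lambda>u. u + t)) \<or> (\<exists>k. g = (\<lambda>u. k - u))"

definition symmetric :: "('a::ab_group_add \<Rightarrow> bool) \<Rightarrow> bool" where
  "symmetric d \<longleftrightarrow> (\<exists>g. motion g \<and> preserves g d)"

definition toggle :: "('a \<Rightarrow> bool) \<Rightarrow> 'a set \<Rightarrow> 'a \<Rightarrow> bool" where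
  "toggle d A u \<longleftrightarrow> d u \<noteq> (u \<in> A)"

definition recolorings :: "('a \<Rightarrow> bool) \<Rightarrow> 'a set \<Rightarrow> ('a \<Rightarrow> bool) set" where
  "recolorings d X = {f. \<forall>u. u \<notin> X \<longrightarrow> f u = d u}"

lemma preservesD: "preserves g d \<Longrightarrow> d (g u) = d u"
  by (simp add: preserves_def)

lemma symmetric_iff: "symmetric d \<longleftrightarrow> (\<exists>t. t \<noteq> 0 \<and> rot_inv d t) \<or> (\<exists>k. refl_inv d k)"
  unfolding symmetric_def motion_def by blast

lemma toggle_in_recolorings [simp]: "toggle d A \<in> recolorings d X \<longleftrightarrow> A \<subseteq> X"
  by (auto simp: recolorings_def toggle_def)

lemma self_in_recolorings [simp]: "d \<in> recolorings d X"
  by (simp add: recolorings_def)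

lemma recolorings_eq: "f \<in> recolorings d X \<Longrightarrow> recolorings f X = recolorings d X"
  by (auto simp: recolorings_def)

lemma preserves_toggle:
  "preserves g d \<Longrightarrow> preserves g (toggle d A) \<longleftrightarrow> preserves g (\<lambda>u. u \<in> A)"
  by (auto simp: preserves_def toggle_def)

lemma preserves_toggle_cancel:
  "preserves g (\<lambda>u. u \<in> A) \<Longrightarrow> preserves g (toggle d A) \<longleftrightarrow> preserves g d"
  by (auto simp: preserves_def toggle_def)

lemma preserves_toggle_change:
  "preserves g (toggle d A) \<Longrightarrow> d (g u) \<noteq> d u \<longleftrightarrow> (u \<in> A) \<noteq> (g u \<in> A)"
  by (auto simp: preserves_def toggle_def)

lemma preserves_ident [simp]: "preserves (\<lambda>u. u) d"
  by (simp add: preserves_def)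

lemma rot_inv_add: "rot_inv d s \<Longrightarrow> rot_inv d t \<Longrightarrow> rot_inv d (s + t)"
  by (simp add: preserves_def flip: add.assoc)

lemma rot_inv_minus: "rot_inv d t \<Longrightarrow> rot_inv d (- t)"
  unfolding preserves_def by (metis add_diff_cancel diff_conv_add_uminus)

lemma rot_inv_diff_if_refl_inv:
  assumes "refl_inv d k" "refl_inv d l"
  shows "rot_inv d (k - l)"
  unfolding preserves_def
proof
  fix u
  have "d (u + (k - l)) = d (k - (u + (k - l)))"
    by (rule preservesD [OF assms(1), symmetric])
  also have "k - (u + (k - l)) = l - u" by simp
  finally show "d (u + (k - l)) = d u"
    using preservesD [OF assms(2)] by simp
qed

lemma refl_inv_pair: "refl_inv (\<lambda>u. u \<in> {x, y}) (x + y)"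
  by (auto simp: preserves_def algebra_simps)

lemma refl_inv_toggle_midpoint: "refl_inv (toggle d {x}) (x + x) \<longleftrightarrow> refl_inv d (x + x)"
  using preserves_toggle_cancel [OF refl_inv_pair [of x x]] by simp

lemma refl_inv_toggle_swap:
  "refl_inv (toggle d {x}) (x + y) \<longleftrightarrow> refl_inv (toggle d {y}) (x + y)"
proof (cases "x = y")
  case False
  then have "toggle d {y} = toggle (toggle d {x}) {x, y}"
    by (auto simp: toggle_def)
  then show ?thesis using preserves_toggle_cancel [OF refl_inv_pair] by metis
qed simp

lemma motion_add_cases:
  assumes "motion g"
  obtains (rotation) "\<And>u h. g (u + h) = g u + h" | (reflection) "\<And>u h. g (u + h) = g u - h"
  using assms unfolding motion_def by (auto simp: algebra_simps)

lemma motion_inj: "motion g \<Longrightarrow> g u = g v \<Longrightarrow> u = v"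
  unfolding motion_def by auto

lemma motion_fixed_point:
  assumes "motion g" "g x = x"
  shows "g = (\<lambda>u. x + x - u)"
  using assms unfolding motion_def by (auto simp: algebra_simps)

lemma motion_rot_inv:
  assumes "motion g" "rot_inv f h"
  shows "f (g (u + h)) = f (g u)"
  using assms(1)
proof (cases rule: motion_add_cases)
  case rotation
  then show ?thesis using preservesD [OF assms(2)] by simp
next
  case reflection
  then show ?thesis using preservesD [OF rot_inv_minus [OF assms(2)], of "g u"] by simp
qed

lemma motion_conjugate:
  assumes "motion g" "motion h"
  obtains h' where "motion h'" "\<And>u. g (h' u) = h (g u)"
proof -
  have refl: "motion (\<lambda>u. k - u)" for k :: 'a unfolding motion_def by blast
  have rot: "motion (\<lambda>u. u + s)" if "s \<noteq> 0" for s :: 'a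
    using that unfolding motion_def by blast
  from assms show ?thesis
    unfolding motion_def [of g] motion_def [of h]
  proof (elim disjE exE conjE)
    fix t s assume "g = (\<lambda>u. u + t)" "h = (\<lambda>u. u + s)" "s \<noteq> 0"
    then show ?thesis using that [OF rot [of s]] by (simp add: ac_simps)
  next
    fix t k assume "g = (\<lambda>u. u + t)" "h = (\<lambda>u. k - u)"
    then show ?thesis using that [OF refl [of "k - t - t"]] by (simp add: algebra_simps)
  next
    fix l s assume "g = (\<lambda>u. l - u)" "h = (\<lambda>u. u + s)" "s \<noteq> 0"
    then show ?thesis using that [OF rot [of "- s"]] by (simp add: algebra_simps)
  next
    fix l k assume "g = (\<lambda>u. l - u)" "h = (\<lambda>u. k - u)"
    then show ?thesis using that [OF refl [of "l + l - k"]] by (simp add: algebra_simps)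
  qed
qed

lemma symmetric_pullback:
  assumes "motion g" "symmetric d"
  shows "symmetric (\<lambda>u. d (g u))"
proof -
  obtain h where "motion h" and h: "preserves h d"
    using assms(2) unfolding symmetric_def by blast
  then obtain h' where "motion h'" "\<And>u. g (h' u) = h (g u)"
    using motion_conjugate [OF assms(1)] by blast
  then show ?thesis
    using preservesD [OF h] unfolding symmetric_def preserves_def by auto
qed

section \<open>Three-point sets\<close>

lemma symmetric_triple_if_isosceles:
  assumes "card X = 3" "a \<in> X" "b \<in> X" "c \<in> X" "distinct [a, b, c]" "a + a = b + c"
  shows "symmetric (\<lambda>u. u \<in> X)"
proof -
  have "finite X" using assms(1) by (intro card_ge_0_finite) simp
  then have "X = {a, b, c}"
    using assms(1-5) by (intro card_seteq [symmetric]) auto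
  then have "refl_inv (\<lambda>u. u \<in> X) (a + a)"
    using assms(6) by (auto simp: preserves_def algebra_simps)
  then show ?thesis unfolding symmetric_iff by blast
qed

lemma isosceles_if_symmetric_triple:
  fixes x :: "'a::single_involution_group"
  assumes "symmetric (\<lambda>u. u \<in> {x, y, z})" "distinct [x, y, z]"
  shows "x + x = y + z \<or> y + y = x + z \<or> z + z = x + y"
  using assms(1) unfolding symmetric_iff
proof (elim disjE exE conjE)
  fix t assume t: "t \<noteq> 0" "rot_inv (\<lambda>u. u \<in> {x, y, z}) t"
  have images: "x + t \<in> {x, y, z}" "y + t \<in> {x, y, z}" "z + t \<in> {x, y, z}"
    using preservesD [OF t(2)] by blast+
  have "x + t \<noteq> y + t" "x + t \<noteq> z + t" "y + t \<noteq> z + t" using assms(2) by auto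
  then consider "x + t = y" "y + t = z" | "x + t = z" "z + t = y"
    using images t(1) by (auto simp del: add_right_cancel)
  then show ?thesis by cases (auto simp: algebra_simps)
next
  fix k assume k: "refl_inv (\<lambda>u. u \<in> {x, y, z}) k"
  have "k - x \<in> {x, y, z}" "k - y \<in> {x, y, z}" "k - z \<in> {x, y, z}"
    using preservesD [OF k] by blast+
  moreover have "\<not> (x + x = k \<and> y + y = k \<and> z + z = k)"
    using at_most_two_halves [of x k y z] assms(2) by auto
  ultimately show ?thesis using assms(2) by (auto simp: algebra_simps)
qed

section \<open>Recolorings with a rotational symmetry\<close>

lemma preserves_if_toggle_monochromatic:
  assumes g: "motion g" and inv: "preserves g (toggle f B)"
    and color: "\<And>u. u \<in> B \<Longrightarrow> f u = a"
  obtains "preserves g f" | v where "\<And>h. rot_inv f h \<Longrightarrow> v + h \<in> B"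
proof (cases "preserves g f")
  case False
  then obtain u where changed: "f (g u) \<noteq> f u" unfolding preserves_def by blast
  have colors: "f (u + h) = f u" "f (g (u + h)) = f (g u)" if "rot_inv f h" for h
    using preservesD [OF that] motion_rot_inv [OF g that] by simp_all
  have moved: "(u + h \<in> B) \<noteq> (g (u + h) \<in> B)" if "rot_inv f h" for h
    using preserves_toggle_change [OF inv, of "u + h"] colors [OF that] changed by simp
  show ?thesis
  proof (cases "f u = a")
    case True
    then have "u + h \<in> B" if "rot_inv f h" for h
      using moved [OF that] colors [OF that] color [of "g (u + h)"] changed by auto
    then show ?thesis using that(2) by blast
  next
    case False
    have image: "g (u + h) \<in> B" if "rot_inv f h" for h
      using moved [OF that] colors [OF that] color [of "u + h"] False by auto
    have "g u + h \<in> B" if h: "rot_inv f h" for h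
      using g
    proof (cases rule: motion_add_cases)
      case rotation
      then show ?thesis using image [OF h] by simp
    next
      case reflection
      have "g (u + - h) = g u + h" using reflection [of u "- h"] by simp
      then show ?thesis using image [OF rot_inv_minus [OF h]] by simp
    qed
    then show ?thesis using that(2) by blast
  qed
qed (use that in blast)

lemma refl_inv_if_toggle_point_symmetric:
  assumes "rot_inv f r" "r \<noteq> 0" and sym: "symmetric (toggle f {x})"
  shows "refl_inv f (x + x)"
proof -
  obtain g where g: "motion g" "preserves g (toggle f {x})"
    using sym unfolding symmetric_def by blast
  have f_inv: "preserves g f"
  proof (rule preserves_if_toggle_monochromatic [OF g])
    fix v assume coset: "\<And>h. rot_inv f h \<Longrightarrow> v + h \<in> {x}"
    then show ?thesis using coset [of 0] coset [of r] assms(1,2) by simp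
  qed auto
  then have "g x = x"
    using g(2) preserves_toggle preservesD by fastforce
  then show ?thesis using f_inv motion_fixed_point [OF g(1)] by simp
qed

text \<open>A translate of \<open>{0, s, 2 * s}\<close> on which the color changes would consist of points of \<open>{x, z}\<close> of one
  color and points mapped to \<open>{x, z}\<close> of the other color, one of each at most.\<close>

lemma antipodal_if_toggle_bichromatic_pair_symmetric:
  assumes s: "rot_inv f s" "s + s \<noteq> 0" and colors: "f x \<noteq> f z"
    and sym: "symmetric (toggle f {x, z})"
  shows "x + x = z + z"
proof -
  obtain g where g: "motion g" and inv: "preserves g (toggle f {x, z})"
    using sym unfolding symmetric_def by blast
  have f_inv: "preserves g f"
  proof (rule ccontr)
    assume "\<not> ?thesis"
    then obtain u where changed: "f (g u) \<noteq> f u" unfolding preserves_def by blast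
    obtain p q where pair: "{x, z} = {p, q}" "f p = f u" "f q \<noteq> f u"
      using colors by (cases "f x = f u") (auto simp: insert_commute)
    have moved: "u + h = p \<or> g (u + h) = q" if h: "rot_inv f h" for h
      using preserves_toggle_change [OF inv, of "u + h"] changed preservesD [OF h]
        motion_rot_inv [OF g h] pair by auto
    have "u = p \<or> g u = q" "u + s = p \<or> g (u + s) = q"
      "u + (s + s) = p \<or> g (u + (s + s)) = q"
      using moved [of 0] moved [OF s(1)] moved [OF rot_inv_add [OF s(1) s(1)]] by simp_all
    moreover have "u \<noteq> u + s" "u \<noteq> u + (s + s)" "u + s \<noteq> u + (s + s)"
      using s(2) by auto
    ultimately show False using motion_inj [OF g] by metis
  qed
  then have "preserves g (\<lambda>u. u \<in> {x, z})" using inv preserves_toggle by blast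
  then have "g x \<in> {x, z}" "g z \<in> {x, z}" unfolding preserves_def by blast+
  moreover have "f (g x) = f x" "f (g z) = f z" using preservesD [OF f_inv] by simp_all
  ultimately have "g x = x" "g z = z" using colors by auto
  then show ?thesis using motion_fixed_point [OF g, of x] by (metis diff_eq_eq)
qed

lemma symmetric_triple_if_toggle_monochromatic:
  assumes s: "rot_inv f s" "s + s \<noteq> 0" and X: "card X = 3" "\<And>u. u \<in> X \<Longrightarrow> f u = a"
    and sym: "symmetric (toggle f X)"
  shows "symmetric (\<lambda>u. u \<in> X)"
proof -
  obtain g where g: "motion g" "preserves g (toggle f X)"
    using sym unfolding symmetric_def by blast
  show ?thesis
  proof (rule preserves_if_toggle_monochromatic [OF g X(2)])
    assume "preserves g f"
    then show ?thesis using g preserves_toggle unfolding symmetric_def by blast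
  next
    fix v assume coset: "\<And>h. rot_inv f h \<Longrightarrow> v + h \<in> X"
    have "v + s \<in> X" "v \<in> X" "v + (s + s) \<in> X"
      using coset [OF s(1)] coset [of 0] coset [OF rot_inv_add [OF s(1) s(1)]] by simp_all
    moreover have "distinct [v + s, v, v + (s + s)]" using s(2) by auto
    ultimately show ?thesis
      by (rule symmetric_triple_if_isosceles [OF X(1)]) (simp add: algebra_simps)
  qed
qed

lemma symmetric_triple_if_doubles_differ_by_involution:
  fixes X :: "'a::single_involution_group set"
  assumes X: "card X = 3" and r: "r + r = 0" "r \<noteq> 0"
    and doubles: "\<And>v w. v \<in> X \<Longrightarrow> w \<in> X \<Longrightarrow> v + v - (w + w) \<in> {0, r}"
  shows "symmetric (\<lambda>u. u \<in> X)"
proof -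
  have isosceles: ?thesis
    if points: "a \<in> X" "b \<in> X" "c \<in> X" "distinct [a, b, c]"
      and antipodal: "a + a = b + b" for a b c
  proof (rule symmetric_triple_if_isosceles [OF X, of c a b])
    have "(b - a) + (b - a) = 0" using antipodal by (simp flip: add_diff_add)
    then have "b - a = r"
      using r(1) by (rule involution_unique) (use points(4) r(2) in auto)
    moreover have "c + c \<noteq> a + a"
      using at_most_two_halves [OF _ refl antipodal [symmetric], of c] points(4) by auto
    then have "c + c - (a + a) = r" using doubles [of c a] points by auto
    ultimately have "c + c - (a + a) = b - a" by simp
    then show "c + c = a + b" by (simp add: algebra_simps)
  qed (use points in auto)
  obtain x y z where X_eq: "X = {x, y, z}" and distinct: "distinct [x, y, z]"
    using X by (auto simp: card_3_iff)
  consider (xy) "x + x - (y + y) = 0" | (xz) "x + x - (z + z) = 0"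
    | (yz) "x + x - (y + y) = x + x - (z + z)"
    using doubles [of x y] doubles [of x z] X_eq by auto
  then show ?thesis
  proof cases
    case xy
    then show ?thesis using isosceles [of x y z] X_eq distinct by simp
  next
    case xz
    then show ?thesis using isosceles [of x z y] X_eq distinct by auto
  next
    case yz
    then have "y + y = z + z" by (metis diff_diff_eq2 add_diff_cancel_left')
    then show ?thesis using isosceles [of y z x] X_eq distinct by auto
  qed
qed

proposition symmetric_triple_if_recoloring_rot_inv:
  fixes f :: "'a::single_involution_group \<Rightarrow> bool"
  assumes X: "card X = 3" and r: "rot_inv f r" "r \<noteq> 0"
    and sym: "\<And>d. d \<in> recolorings f X \<Longrightarrow> symmetric d"
  shows "symmetric (\<lambda>u. u \<in> X)"
proof (cases "\<exists>s. rot_inv f s \<and> s + s \<noteq> 0")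
  case True
  then obtain s where s: "rot_inv f s" "s + s \<noteq> 0" by blast
  obtain x y z where X_eq: "X = {x, y, z}" and distinct: "distinct [x, y, z]"
    using X by (auto simp: card_3_iff)
  have antipodal: "v + v = w + w" if "v \<in> X" "w \<in> X" "f v \<noteq> f w" for v w
    using antipodal_if_toggle_bichromatic_pair_symmetric [OF s that(3) sym] that(1,2) by simp
  have "f x = f y \<and> f x = f z"
  proof (rule ccontr)
    assume "\<not> ?thesis"
    then have "y + y = x + x \<and> z + z = x + x"
      using antipodal [of x y] antipodal [of x z] antipodal [of y z] X_eq by (metis insertCI)
    then show False using at_most_two_halves [of x "x + x" y z] distinct by simp
  qed
  then have "f u = f x" if "u \<in> X" for u using that X_eq by auto
  then show ?thesis
    using symmetric_triple_if_toggle_monochromatic [OF s X _ sym] by auto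
next
  case False
  then have "t \<in> {0, r}" if "rot_inv f t" for t
    using that r involution_unique by blast
  moreover have "refl_inv f (v + v)" if "v \<in> X" for v
    using refl_inv_if_toggle_point_symmetric [OF r sym] that by simp
  ultimately have "v + v - (w + w) \<in> {0, r}" if "v \<in> X" "w \<in> X" for v w
    using that rot_inv_diff_if_refl_inv by blast
  then show ?thesis
    using symmetric_triple_if_doubles_differ_by_involution [OF X] False r by blast
qed

section \<open>Recolorings with reflections only\<close>

text \<open>The two reflections compose to the rotation by \<open>e - x\<close>, which moves \<open>x\<close> to \<open>e\<close> and \<open>k - e\<close>
  to \<open>k - x\<close>.\<close>

definition jump_target :: "('a::ab_group_add \<Rightarrow> bool) \<Rightarrow> 'a \<Rightarrow> 'a \<Rightarrow> 'a \<Rightarrow> bool" where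
  "jump_target d k x e \<longleftrightarrow> refl_inv d k \<and> refl_inv (toggle d {x}) (k - e + x) \<and> x \<noteq> k - e"

lemma jump_target_change:
  assumes "jump_target d k x e"
  shows "d (u + (e - x)) \<noteq> d u \<longleftrightarrow> u = x \<or> u = k - e"
proof -
  have axis: "refl_inv d k" and axis_x: "refl_inv (toggle d {x}) (k - e + x)" and "x \<noteq> k - e"
    using assms by (simp_all add: jump_target_def)
  have "d (u + (e - x)) = d (k - (u + (e - x)))"
    by (rule preservesD [OF axis, symmetric])
  also have "k - (u + (e - x)) = k - e + x - u" by (simp add: algebra_simps)
  finally have "d (u + (e - x)) = d (k - e + x - u)" .
  moreover have "k - e + x - u = x \<longleftrightarrow> u = k - e" by auto
  ultimately show ?thesis
    using preserves_toggle_change [OF axis_x, of u] \<open>x \<noteq> k - e\<close> by auto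
qed

lemma jump_target_color:
  assumes "jump_target d k x e"
  shows "d e \<noteq> d x" "d (k - e) \<noteq> d x"
proof -
  show "d e \<noteq> d x" using jump_target_change [OF assms, of x] by simp
  moreover have "d (k - e) = d e" using assms by (simp add: jump_target_def preserves_def)
  ultimately show "d (k - e) \<noteq> d x" by simp
qed

text \<open>The rotations by \<open>e - x\<close> and \<open>h - y\<close> commute; the next two proofs compare the colors met along
  both orders.\<close>

lemma jump_targets_reflected:
  assumes e: "jump_target d k x e" and h: "jump_target d k y h"
    and xy: "x \<noteq> y" "d x = d y"
  shows "e = k - h"
proof -
  have "h \<noteq> y" using jump_target_color [OF h] by auto
  have "d (x + (h - y)) = d x"
    using jump_target_change [OF h, of x] xy jump_target_color(2) [OF h] by auto
  moreover from this have "d (x + (h - y) + (e - x)) = d (x + (h - y))"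
    using jump_target_change [OF e, of "x + (h - y)"] jump_target_color(2) [OF e] \<open>h \<noteq> y\<close>
    by auto
  ultimately have "d (e + (h - y)) \<noteq> d e"
    using jump_target_color(1) [OF e] by (simp add: algebra_simps)
  then show ?thesis
    using jump_target_change [OF h, of e] jump_target_color(1) [OF e] xy(2) by auto
qed

lemma jump_targets_eq:
  assumes e: "jump_target d k x e" and h: "jump_target d k y h"
    and xy: "x \<noteq> y" "d x = d y" "x + y \<noteq> k"
  shows "e = h"
proof -
  have "h \<noteq> y" using jump_target_color [OF h] by auto
  have "x - (h - y) \<noteq> y" using jump_target_color(1) [OF h] xy(2) by (auto simp: algebra_simps)
  moreover have "x - (h - y) \<noteq> k - h" using xy(3) by (auto simp: algebra_simps)
  ultimately have "d (x - (h - y)) = d x"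
    using jump_target_change [OF h, of "x - (h - y)"] by simp
  moreover from this have "d (x - (h - y) + (e - x)) = d (x - (h - y))"
    using jump_target_change [OF e, of "x - (h - y)"] jump_target_color(2) [OF e] \<open>h \<noteq> y\<close>
    by auto
  ultimately have "d (e - (h - y) + (h - y)) \<noteq> d (e - (h - y))"
    using jump_target_color(1) [OF e] by (simp add: algebra_simps)
  then have "e - (h - y) = y \<or> e - (h - y) = k - h"
    using jump_target_change [OF h, of "e - (h - y)"] by blast
  then show ?thesis
    using jump_targets_reflected [OF e h xy(1,2)] \<open>h \<noteq> y\<close> by (auto simp: algebra_simps)
qed

definition reflections_only :: "('a::ab_group_add \<Rightarrow> bool) \<Rightarrow> 'a set \<Rightarrow> bool" where
  "reflections_only d X \<longleftrightarrow>
    (\<forall>f\<in>recolorings d X. (\<exists>k. refl_inv f k) \<and> (\<forall>t. rot_inv f t \<longrightarrow> t = 0))"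

lemma reflections_only_recoloring:
  "reflections_only d X \<Longrightarrow> f \<in> recolorings d X \<Longrightarrow> reflections_only f X"
  by (simp add: reflections_only_def recolorings_eq)

lemma reflections_only_refl_inv:
  assumes "reflections_only d X" "f \<in> recolorings d X"
  obtains k where "refl_inv f k"
  using assms unfolding reflections_only_def by blast

lemma reflections_only_rot_inv:
  "reflections_only d X \<Longrightarrow> f \<in> recolorings d X \<Longrightarrow> rot_inv f t \<Longrightarrow> t = 0"
  unfolding reflections_only_def by blast

lemma reflections_only_axis_unique:
  assumes "reflections_only d X" "refl_inv d k" "refl_inv d l"
  shows "k = l"
  using reflections_only_rot_inv [OF assms(1) _ rot_inv_diff_if_refl_inv [OF assms(2,3)]] by simp

definition rotation_center :: "('a::ab_group_add \<Rightarrow> bool) \<Rightarrow> 'a \<Rightarrow> 'a \<Rightarrow> bool" where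
  "rotation_center d e x \<longleftrightarrow> d e \<noteq> d x \<and> rot_inv (toggle d {e}) (e - x)"

lemma jump_target_exists:
  assumes ro: "reflections_only d X" and axis: "refl_inv d k" and w: "w \<in> X" "w + w \<noteq> k"
  obtains e where "jump_target d k w e"
proof -
  obtain l where l: "refl_inv (toggle d {w}) l"
    using reflections_only_refl_inv [OF ro, of "toggle d {w}"] w(1) by auto
  have "l \<noteq> w + w"
    using l reflections_only_axis_unique [OF ro axis] w(2) refl_inv_toggle_midpoint by metis
  then have "jump_target d k w (k - l + w)"
    using axis l by (auto simp: jump_target_def algebra_simps)
  then show ?thesis by (rule that)
qed

lemma rotation_center_if_jump_target:
  assumes "jump_target d k x e" "e + e = k"
  shows "rotation_center d e x"
proof -
  have "refl_inv (toggle d {e}) (e + e)"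
    using assms refl_inv_toggle_midpoint unfolding jump_target_def by blast
  moreover have "k - e = e" using assms(2) by auto
  then have "refl_inv (toggle d {e}) (x + e)"
    using assms(1) refl_inv_toggle_swap [of x e d] by (simp add: jump_target_def add.commute)
  ultimately have "rot_inv (toggle d {e}) (e - x)" using rot_inv_diff_if_refl_inv by fastforce
  then show ?thesis using jump_target_color(1) [OF assms(1)] by (simp add: rotation_center_def)
qed

lemma rotation_center_exists:
  assumes ro: "reflections_only d X" and axis: "refl_inv d k" and z: "z \<in> X" "z + z \<noteq> k"
  obtains e where "\<And>w. w \<in> X \<Longrightarrow> w \<noteq> z \<Longrightarrow> d w = d z \<Longrightarrow> w + w \<noteq> k \<Longrightarrow> w + z \<noteq> k \<Longrightarrow>
    e + e = k \<and> rotation_center d e z \<and> rotation_center d e w"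
proof -
  obtain e where e: "jump_target d k z e" using jump_target_exists [OF ro axis z] .
  show ?thesis
  proof (rule that)
    fix w assume w: "w \<in> X" "w \<noteq> z" "d w = d z" "w + w \<noteq> k" "w + z \<noteq> k"
    obtain h where h: "jump_target d k w h" using jump_target_exists [OF ro axis w(1,4)] .
    have "h = e" by (rule jump_targets_eq [OF h e w(2,3,5)])
    moreover from this have "e + e = k"
      using jump_targets_reflected [OF h e w(2,3)] by (simp add: algebra_simps)
    ultimately show "e + e = k \<and> rotation_center d e z \<and> rotation_center d e w"
      using rotation_center_if_jump_target e h by blast
  qed
qed

lemma symmetric_set_if_toggle_symmetric:
  assumes r: "rot_inv f r" "r \<noteq> 0" and B: "\<And>u. u \<in> B \<Longrightarrow> rot_inv f (u - p)"
    and sym: "symmetric (toggle f B)"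
  shows "symmetric (\<lambda>u. u \<in> B)"
proof -
  have color: "f u = f p" if "u \<in> B" for u
    using preservesD [OF B [OF that], of p] by simp
  obtain g where g: "motion g" "preserves g (toggle f B)"
    using sym unfolding symmetric_def by blast
  show ?thesis
  proof (rule preserves_if_toggle_monochromatic [OF g color])
    assume "preserves g f"
    then show ?thesis using g preserves_toggle unfolding symmetric_def by blast
  next
    fix v assume coset: "\<And>h. rot_inv f h \<Longrightarrow> v + h \<in> B"
    have "v \<in> B" using coset [of 0] by simp
    then have "rot_inv f (p - v)" using rot_inv_minus [OF B] by fastforce
    then have "u \<in> B" if "rot_inv f (u - p)" for u
      using coset [of "p - v + (u - p)"] rot_inv_add that by fastforce
    then have B_iff: "u \<in> B \<longleftrightarrow> rot_inv f (u - p)" for u using B by blast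
    have "rot_inv f (u + r - p) \<longleftrightarrow> rot_inv f (u - p)" for u
      using rot_inv_add [OF _ r(1), of "u - p"]
        rot_inv_add [OF _ rot_inv_minus [OF r(1)], of "u + r - p"]
      by (auto simp: algebra_simps)
    then have "rot_inv (\<lambda>u. u \<in> B) r" unfolding B_iff preserves_def by simp
    then show ?thesis using r(2) unfolding symmetric_iff by blast
  qed
qed

lemma symmetric_insert_rotation_center:
  assumes sym: "symmetric (toggle d A)" and A: "A \<subseteq> X" and X: "X \<noteq> {}"
    and center: "\<And>w. w \<in> X \<Longrightarrow> rotation_center d e w"
  shows "symmetric (\<lambda>u. u \<in> insert e A)"
proof -
  have e: "e \<notin> X" using center unfolding rotation_center_def by blast
  have rot: "rot_inv (toggle d {e}) (e - w)" if "w \<in> X" for w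
    using center [OF that] by (simp add: rotation_center_def)
  obtain w where w: "w \<in> X" using X by blast
  have "toggle (toggle d {e}) (insert e A) = toggle d A"
    using e A by (auto simp: toggle_def fun_eq_iff)
  then have "symmetric (toggle (toggle d {e}) (insert e A))" using sym by simp
  moreover have "rot_inv (toggle d {e}) (u - e)" if "u \<in> insert e A" for u
    using rot_inv_minus [OF rot, of u] that A by auto
  ultimately show ?thesis
    using symmetric_set_if_toggle_symmetric [OF rot [OF w], of "insert e A" e] w e by auto
qed

lemma symmetric_if_common_rotation_center:
  assumes sym: "\<And>f. f \<in> recolorings d X \<Longrightarrow> symmetric f"
    and X: "X \<noteq> {}" and center: "\<And>w. w \<in> X \<Longrightarrow> rotation_center d e w"
  shows "symmetric (\<lambda>u. u \<in> X)"
proof -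
  have e: "e \<notin> X" using center unfolding rotation_center_def by blast
  have insert_sym: "symmetric (\<lambda>u. u \<in> insert e A)" if "A \<subseteq> X" for A
    using symmetric_insert_rotation_center [OF sym that X center] that by simp
  obtain g where g: "motion g" and inv: "preserves g (\<lambda>u. u \<in> insert e X)"
    using insert_sym [of X] unfolding symmetric_def by blast
  have image_iff: "g u \<in> insert e X \<longleftrightarrow> u \<in> insert e X" for u
    using inv by (simp add: preserves_def)
  show ?thesis
  proof (cases "g e = e")
    case True
    then have "g u \<in> X \<longleftrightarrow> u \<in> X" for u
      using image_iff [of u] e motion_inj [OF g, of u e] by auto
    then show ?thesis using g unfolding symmetric_def preserves_def by blast
  next
    case False
    then have "insert e (X - {g e}) = insert e X - {g e}" by blast
    then have "symmetric (\<lambda>u. g u \<in> insert e X - {g e})"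
      using symmetric_pullback [OF g insert_sym [of "X - {g e}"]] by auto
    moreover have "g u \<in> insert e X - {g e} \<longleftrightarrow> u \<in> X" for u
      using image_iff [of u] e motion_inj [OF g, of u e] by auto
    ultimately show ?thesis by simp
  qed
qed

lemma not_rotation_center_toggle:
  assumes "rotation_center d e y" "e \<noteq> x"
  shows "\<not> rotation_center (toggle d {x}) e y"
proof
  assume "rotation_center (toggle d {x}) e y"
  moreover have "toggle (toggle d {x}) {e} = toggle (toggle d {e}) {x}"
    by (auto simp: toggle_def fun_eq_iff)
  ultimately have "rot_inv (\<lambda>u. u \<in> {x}) (e - y)"
    using assms(1) preserves_toggle by (fastforce simp: rotation_center_def)
  then have "e - y = 0" unfolding preserves_def by auto
  then show False using assms(1) by (auto simp: rotation_center_def)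
qed

lemma reflections_only_not_rotation_center:
  assumes "reflections_only d X"
  shows "\<not> rotation_center (toggle d {x}) x y"
proof
  assume center: "rotation_center (toggle d {x}) x y"
  have "toggle (toggle d {x}) {x} = d" by (auto simp: toggle_def fun_eq_iff)
  then have "x - y = 0"
    using center reflections_only_rot_inv [OF assms self_in_recolorings]
    by (fastforce simp: rotation_center_def)
  then show False using center by (simp add: rotation_center_def)
qed

text \<open>With \<open>x\<close> on the axis, the recolorings \<open>d\<close> and \<open>toggle d {x}\<close> have the same axis, hence the same
  rotation center, since the center is the point of the axis other than \<open>x\<close>.\<close>

lemma axis_through_point_pairs_others:
  fixes d :: "'a::single_involution_group \<Rightarrow> bool"
  assumes ro: "reflections_only d X" and X: "x \<in> X" "y \<in> X" "z \<in> X" "y \<noteq> z"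
    and axis: "refl_inv d (x + x)" and colors: "d x = d z" "d y = d z"
    and off_axis: "y + y \<noteq> x + x" "z + z \<noteq> x + x"
  shows "y + z = x + x"
proof (rule ccontr)
  assume unpaired: "y + z \<noteq> x + x"
  have center: "\<exists>e. e + e = x + x \<and> rotation_center f e y"
    if "f \<in> recolorings d X" "refl_inv f (x + x)" "f y = f z" for f
    using rotation_center_exists
        [OF reflections_only_recoloring [OF ro that(1)] that(2) X(3) off_axis(2)]
      X off_axis(1) unpaired that(3) by metis
  define f where "f = toggle d {x}"
  have "f \<in> recolorings d X" "refl_inv f (x + x)" "f y = f z"
    using X axis colors(2) off_axis refl_inv_toggle_midpoint [of x d]
    by (auto simp: f_def toggle_def)
  then obtain e' where e': "e' + e' = x + x" "rotation_center f e' y"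
    using center by blast
  obtain e where e: "e + e = x + x" "rotation_center d e y"
    using center [OF _ axis colors(2)] by auto
  have "e \<noteq> x" using e(2) colors by (auto simp: rotation_center_def)
  moreover have "e' \<noteq> x"
    using e'(2) reflections_only_not_rotation_center [OF ro] by (auto simp: f_def)
  ultimately have "e' = e" using at_most_two_halves [OF e'(1) e(1), of x] by blast
  then show False
    using e(2) e'(2) \<open>e \<noteq> x\<close> not_rotation_center_toggle unfolding f_def by blast
qed

lemma unpaired_element_of_triple:
  fixes X :: "'a::ab_group_add set"
  assumes "card X = 3"
  obtains z where "z \<in> X" "\<And>w. w \<in> X \<Longrightarrow> w \<noteq> z \<Longrightarrow> w + z \<noteq> k"
proof -
  obtain x y z where X_eq: "X = {x, y, z}" and distinct: "x \<noteq> y" "y \<noteq> z" "x \<noteq> z"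
    using assms by (auto simp: card_3_iff)
  have "y + x \<noteq> z + x" "x + y \<noteq> z + y" "x + z \<noteq> y + z"
    using distinct by simp_all
  then consider "y + x \<noteq> k" "z + x \<noteq> k" | "x + y \<noteq> k" "z + y \<noteq> k"
    | "x + z \<noteq> k" "y + z \<noteq> k"
    by (metis add.commute)
  then show ?thesis
    by cases (use that X_eq in blast)+
qed

lemma axis_through_two_points:
  fixes d :: "'a::single_involution_group \<Rightarrow> bool"
  assumes ro: "reflections_only d X" and X: "card X = 3" "\<not> symmetric (\<lambda>u. u \<in> X)"
    and axis: "refl_inv d k" and color: "\<And>u. u \<in> X \<Longrightarrow> d u = a"
  obtains x y where "x \<in> X" "y \<in> X" "x \<noteq> y" "x + x = k" "y + y = k"
proof (cases "\<exists>x\<in>X. x + x = k")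
  case True
  then obtain x where x: "x \<in> X" "x + x = k" by blast
  then have "card (X - {x}) = 2" using X(1) by simp
  then obtain y z where "X - {x} = {y, z}" "y \<noteq> z" by (auto simp: card_2_iff)
  then have yz: "y \<in> X" "z \<in> X" "distinct [x, y, z]" by auto
  have "y + z \<noteq> k"
    using symmetric_triple_if_isosceles [OF X(1) x(1) yz] x(2) X(2) by auto
  then have "y + y = k \<or> z + z = k"
    using axis_through_point_pairs_others [OF ro x(1) yz(1,2)] axis x yz color by auto
  then show ?thesis using that x yz by auto
next
  case False
  obtain z where z: "z \<in> X" "\<And>w. w \<in> X \<Longrightarrow> w \<noteq> z \<Longrightarrow> w + z \<noteq> k"
    using unpaired_element_of_triple [OF X(1)] by metis
  then have "z + z \<noteq> k" using False by blast
  obtain e where e: "rotation_center d e z \<and> rotation_center d e w" if "w \<in> X" "w \<noteq> z" for w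
    using rotation_center_exists [OF ro axis z(1) \<open>z + z \<noteq> k\<close>] z False color by metis
  have "X \<noteq> {z}" using X(1) by auto
  then have "rotation_center d e w" if "w \<in> X" for w
    using e that z(1) by (metis singleton_iff subsetI subset_singleton_iff empty_iff)
  moreover have "symmetric f" if "f \<in> recolorings d X" for f
    using reflections_only_refl_inv [OF ro that] symmetric_iff by blast
  ultimately show ?thesis
    using symmetric_if_common_rotation_center [of d X e] X(2) z(1) by blast
qed

theorem symmetric_triple_if_recolorings_symmetric:
  fixes c :: "'a::single_involution_group \<Rightarrow> bool"
  assumes X: "card X = 3" and sym: "\<And>f. f \<in> recolorings c X \<Longrightarrow> symmetric f"
  shows "symmetric (\<lambda>u. u \<in> X)"
proof (rule ccontr)
  assume asym: "\<not> ?thesis"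
  have ro: "reflections_only c X"
    unfolding reflections_only_def
  proof
    fix f assume f: "f \<in> recolorings c X"
    have "t = 0" if "rot_inv f t" for t
      using symmetric_triple_if_recoloring_rot_inv [OF X that] sym recolorings_eq [OF f] asym
      by blast
    then show "(\<exists>k. refl_inv f k) \<and> (\<forall>t. rot_inv f t \<longrightarrow> t = 0)"
      using sym [OF f] unfolding symmetric_iff by blast
  qed
  define d where "d u \<longleftrightarrow> u \<notin> X \<and> c u" for u
  have d: "reflections_only d X" "reflections_only (toggle d X) X"
    by (rule reflections_only_recoloring [OF ro]; auto simp: d_def recolorings_def toggle_def)+
  obtain k where k: "refl_inv d k"
    using reflections_only_refl_inv [OF d(1) self_in_recolorings] .
  obtain l where l: "refl_inv (toggle d X) l"
    using reflections_only_refl_inv [OF d(2) self_in_recolorings] .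
  obtain x y where on_axis: "x \<in> X" "y \<in> X" "x \<noteq> y" "x + x = k" "y + y = k"
    using axis_through_two_points [OF d(1) X asym k] by (auto simp: d_def)
  obtain v w where on_axis': "v \<in> X" "w \<in> X" "v \<noteq> w" "v + v = l" "w + w = l"
    using axis_through_two_points [OF d(2) X asym l] by (auto simp: d_def toggle_def)
  have "{x, y} \<inter> {v, w} \<noteq> {}"
  proof
    assume "{x, y} \<inter> {v, w} = {}"
    then have "card {x, y, v, w} = 4" using on_axis(3) on_axis'(3) by auto
    moreover have "finite X" using X by (intro card_ge_0_finite) simp
    ultimately show False using card_mono [of X "{x, y, v, w}"] X on_axis on_axis' by simp
  qed
  then have "k = l" using on_axis on_axis' by auto
  then show False using k l preserves_toggle asym unfolding symmetric_iff by blast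
qed

section \<open>The circle\<close>

quotient_type circle = real / "\<lambda>x y. x - y \<in> \<int>"
proof (rule equivpI)
  show "symp (\<lambda>x y::real. x - y \<in> \<int>)"
    by (rule sympI) (metis Ints_minus minus_diff_eq)
  show "transp (\<lambda>x y::real. x - y \<in> \<int>)"
    by (rule transpI) (metis Ints_add diff_add_cancel add_diff_eq)
qed (simp add: reflp_def)

instantiation circle :: ab_group_add
begin

lift_definition zero_circle :: circle is 0 .

lift_definition plus_circle :: "circle \<Rightarrow> circle \<Rightarrow> circle" is "(+)"
  by (metis Ints_add add_diff_add)

lift_definition uminus_circle :: "circle \<Rightarrow> circle" is uminus
  by (metis Ints_minus minus_diff_minus)

lift_definition minus_circle :: "circle \<Rightarrow> circle \<Rightarrow> circle" is "(-)"
  by (metis Ints_diff diff_diff_eq diff_add_eq diff_diff_eq2 add_diff_eq add.commute)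

instance
  by standard (transfer; simp)+

end

instance circle :: single_involution_group
proof
  fix s t :: circle
  assume "s + s = 0" "t + t = 0" "s \<noteq> 0" "t \<noteq> 0"
  then show "s = t"
  proof transfer
    fix s t :: real
    have odd_double: "\<exists>n. u + u = of_int n \<and> odd n"
      if u: "u + u - 0 \<in> \<int>" "u - 0 \<notin> \<int>" for u :: real
    proof -
      obtain n where n: "u + u - 0 = of_int n" using u(1) by (rule Ints_cases)
      have "odd n"
      proof
        assume "even n"
        then obtain j where "n = 2 * j" by blast
        then have "u = of_int j" using n by simp
        then show False using u(2) by simp
      qed
      then show ?thesis using n by auto
    qed
    assume "s + s - 0 \<in> \<int>" "t + t - 0 \<in> \<int>" "s - 0 \<notin> \<int>" "t - 0 \<notin> \<int>"
    then obtain m n where "s + s = of_int m" "t + t = of_int n" and odd: "odd m" "odd n"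
      using odd_double by meson
    then have "2 * (s - t) = of_int (m - n)" by simp
    moreover have "even (m - n)" using odd by simp
    then obtain j where "m - n = 2 * j" by blast
    ultimately have "s - t = of_int j" by simp
    then show "s - t \<in> \<int>" by simp
  qed
qed

lift_definition representative :: "circle \<Rightarrow> real" is frac
  by (rule frac_diff_zero) simp

lemma abs_circle_frac [simp]: "abs_circle (frac x) = abs_circle x"
  by (simp add: circle.abs_eq_iff frac_def)

lemma representative_abs_circle: "x \<in> S1 \<Longrightarrow> representative (abs_circle x) = x"
  by (simp add: representative.abs_eq S1_def)

lemma abs_circle_representative: "abs_circle (representative u) = u"
  by (induction u) (simp add: representative.abs_eq)

lemma representative_in_S1: "representative u \<in> S1"
  by (induction u) (simp add: representative.abs_eq S1_def frac_lt_1)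

lemma act_in_S1: "act g x \<in> S1"
  by (cases g) (simp_all add: S1_def frac_lt_1)

lemma abs_circle_act:
  "abs_circle (act (Rot a) x) = abs_circle x + abs_circle a"
  "abs_circle (act (Refl a) x) = abs_circle (2 * a) - abs_circle x"
  by (simp_all add: plus_circle.abs_eq minus_circle.abs_eq)

lemma distinguishing_if_not_symmetric:
  assumes "\<not> symmetric d"
  shows "distinguishing (\<lambda>x. d (abs_circle x))"
  unfolding distinguishing_def
proof (intro allI impI)
  fix g
  assume "\<forall>x\<in>S1. d (abs_circle (act g x)) = d (abs_circle x)"
  then have inv: "d (abs_circle (act g (representative u))) = d u" for u
    by (metis representative_in_S1 abs_circle_representative)
  show "is_identity g"
  proof (cases g)
    case (Rot a)
    then have "rot_inv d (abs_circle a)"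
      using inv by (simp add: preserves_def abs_circle_act abs_circle_representative del: act.simps)
    then have "abs_circle a = 0" using assms unfolding symmetric_iff by blast
    then have "abs_circle (act g x) = abs_circle x" for x
      using Rot by (simp add: abs_circle_act del: act.simps)
    then show ?thesis
      unfolding is_identity_def by (metis representative_abs_circle act_in_S1)
  next
    case (Refl a)
    then have "refl_inv d (abs_circle (2 * a))"
      using inv by (simp add: preserves_def abs_circle_act abs_circle_representative del: act.simps)
    then show ?thesis using assms unfolding symmetric_iff by blast
  qed
qed

lemma symmetric_triple_if_not_P:
  assumes W: "W \<subseteq> S1" "\<not> P W" and X: "X \<subseteq> abs_circle ` W" "card X = 3"
  shows "symmetric (\<lambda>u. u \<in> X)"
proof -
  obtain c where c: "\<And>d. distinguishing d \<Longrightarrow> \<exists>x\<in>S1 - W. d x \<noteq> c x"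
    using W(2) unfolding P_def by metis
  have "symmetric f" if f: "f \<in> recolorings (\<lambda>u. c (representative u)) X" for f
  proof (rule ccontr)
    assume "\<not> symmetric f"
    then obtain x where x: "x \<in> S1 - W" "f (abs_circle x) \<noteq> c x"
      using c distinguishing_if_not_symmetric by blast
    have "abs_circle x \<notin> abs_circle ` W"
      using x(1) W(1) representative_abs_circle by (metis DiffE imageE subsetD)
    then have "f (abs_circle x) = c (representative (abs_circle x))"
      using f X(1) unfolding recolorings_def by blast
    then show False using x representative_abs_circle by simp
  qed
  then show ?thesis by (rule symmetric_triple_if_recolorings_symmetric [OF X(2)])
qed

lemma abs_circle_eq_iff_if_close:
  "\<bar>x - y\<bar> < 1 \<Longrightarrow> abs_circle x = abs_circle y \<longleftrightarrow> x = y"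
  using Ints_nonzero_abs_less1 [of "x - y"] by (auto simp: circle.abs_eq_iff)

lemma isosceles_arc_lengths:
  assumes "symmetric (\<lambda>u. u \<in> {abs_circle p, abs_circle q, abs_circle r})"
    and less: "p < q" "q < r" "r < p + 1"
  shows "q - p = r - q \<or> 2 * (q - p) + (r - q) = 1 \<or> (q - p) + 2 * (r - q) = 1"
proof -
  have zero: "u = 0" if "u \<in> \<int>" "\<bar>u\<bar> < 1" for u :: real
    using Ints_nonzero_abs_less1 that by blast
  have "distinct [abs_circle p, abs_circle q, abs_circle r]"
    using less by (simp add: abs_circle_eq_iff_if_close)
  from isosceles_if_symmetric_triple [OF assms(1) this]
  consider (apex_p) "p + p - (q + r) \<in> \<int>" | (apex_q) "q + q - (p + r) \<in> \<int>"
    | (apex_r) "r + r - (p + q) \<in> \<int>"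
    by (auto simp: plus_circle.abs_eq circle.abs_eq_iff)
  then show ?thesis
  proof cases
    case apex_p
    then have "p + p - (q + r) + 1 = 0" using less by (intro zero) auto
    then show ?thesis by simp
  next
    case apex_q
    then have "q + q - (p + r) = 0" using less by (intro zero) auto
    then show ?thesis by simp
  next
    case apex_r
    then have "r + r - (p + q) - 1 = 0" using less by (intro zero) auto
    then show ?thesis by simp
  qed
qed

lemma four_arcs_isosceles_cases:
  fixes a b c :: real
  assumes "0 < a" "0 < b" "0 < c" "a + b + c < 1"
    and "a = b \<or> 2 * a + b = 1 \<or> a + 2 * b = 1"
    and "b = c \<or> 2 * b + c = 1 \<or> b + 2 * c = 1"
    and "a = b + c \<or> 2 * a + (b + c) = 1 \<or> a + 2 * (b + c) = 1"
    and "a + b = c \<or> 2 * (a + b) + c = 1 \<or> (a + b) + 2 * c = 1"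
  shows "a = 1 / 5 \<or> b = 1 / 5 \<or> (a = 1 / 4 \<and> b = 1 / 4 \<and> c = 1 / 4)"
  using assms(5-8) assms(1-4) by (elim disjE) auto

lemma isosceles_quadruple_arc_lengths:
  assumes less: "p < q" "q < r" "r < s" "s < p + 1"
    and sym: "\<And>X. X \<subseteq> abs_circle ` {p, q, r, s} \<Longrightarrow> card X = 3 \<Longrightarrow> symmetric (\<lambda>u. u \<in> X)"
  shows "q - p = 1 / 5 \<or> r - q = 1 / 5 \<or> (q - p = 1 / 4 \<and> r - q = 1 / 4 \<and> s - r = 1 / 4)"
proof -
  have arcs: "y - x = z - y \<or> 2 * (y - x) + (z - y) = 1 \<or> (y - x) + 2 * (z - y) = 1"
    if xyz: "x < y" "y < z" "{x, y, z} \<subseteq> {p, q, r, s}" for x y z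
  proof (rule isosceles_arc_lengths)
    show "z < x + 1" using xyz less by auto
    then have "card {abs_circle x, abs_circle y, abs_circle z} = 3"
      using xyz(1,2) by (simp add: abs_circle_eq_iff_if_close)
    then show "symmetric (\<lambda>u. u \<in> {abs_circle x, abs_circle y, abs_circle z})"
      using xyz(3) by (intro sym) auto
  qed (use xyz in auto)
  show ?thesis
    using four_arcs_isosceles_cases [of "q - p" "r - q" "s - r"]
      arcs [of p q r] arcs [of q r s] arcs [of p q s] arcs [of p r s] less by simp
qed

lemma T2_diff_neq_fifth:
  assumes "W \<subseteq> S1" "T2 W" "v \<in> W" "w \<in> W"
  shows "w - v \<noteq> 1 / 5"
proof
  assume "w - v = 1 / 5"
  then have "frac (v + real 1 / 5) = w"
    using assms(1,4) by (auto simp: S1_def)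
  then have "w \<in> (\<lambda>x. frac (x + real 1 / 5)) ` W \<inter> W" using assms(3,4) by blast
  then show False using assms(2) unfolding T2_def by fastforce
qed

lemma card_4_sorted:
  fixes W :: "'a::linorder set"
  assumes "card W = 4"
  obtains p q r s where "W = {p, q, r, s}" "p < q" "q < r" "r < s"
proof -
  have "finite W" using assms by (intro card_ge_0_finite) simp
  then obtain l where l: "sorted_wrt (<) l" "set l = W" "length l = 4"
    using assms by (metis finite_set_strict_sorted)
  then obtain p q r s where "l = [p, q, r, s]"
    by (auto simp: numeral_eq_Suc length_Suc_conv)
  then show ?thesis using that l by auto
qed

theorem theorem2p4p1:
  fixes W :: "real set"
  assumes "W \<subseteq> S1"
    and "card W = 4"
    and "trivial_pointwise_stabilizer W"
    and "T2 W"
  shows "P W \<or> congruent_sets W {0, 1/4, 1/2, 3/4}"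
proof (cases "P W")
  case False
  obtain p q r s where W: "W = {p, q, r, s}" and less: "p < q" "q < r" "r < s"
    using card_4_sorted [OF assms(2)] .
  have "s < p + 1" using assms(1) W by (auto simp: S1_def)
  then have "q - p = 1 / 5 \<or> r - q = 1 / 5 \<or> (q - p = 1 / 4 \<and> r - q = 1 / 4 \<and> s - r = 1 / 4)"
    using isosceles_quadruple_arc_lengths [OF less] symmetric_triple_if_not_P [OF assms(1) False] W
    by blast
  moreover have "q - p \<noteq> 1 / 5" "r - q \<noteq> 1 / 5"
    using T2_diff_neq_fifth [OF assms(1,4)] W by simp_all
  ultimately have "W = {p, p + 1 / 4, p + 1 / 2, p + 3 / 4}" unfolding W by auto
  then have "act (Rot (- p)) ` W = {0, 1 / 4, 1 / 2, 3 / 4}" by simp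
  then show ?thesis unfolding congruent_sets_def by metis
qed simp

end
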